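(* For fixed aggressiveness $G$ and prior probability $p=p(1)$, the sender's a priori expected equilibrium utility $\tilde U^S$ is not necessarily a decreasing function of detector quality $J$. That is, there exist utility functions $u^S,u^R$ satisfying the assumptions of the cheap-talk signaling game with evidence, a value $G\in(-1,1)$ with $G\neq0$, a prior $p\in(0,1)$, and qualities $0<J_1<J_2\le 1-|G|$ (with $p$ not equal to any regime boundary for the detectors $(J_1,G)$ and $(J_2,G)$) such that $\tilde U^S$ at $(J_1,G,p)$ is strictly smaller than $\tilde U^S$ at $(J_2,G,p)$.
   Context: Cheap-talk signaling game with evidence. A type $\theta\in\{0,1\}$ has prior $p(1)=p$, $p(0)=1-p$. A sender $S$ of type $\theta$ sends $m\in\{0,1\}$ with probability $\sigma^S(m\,|\,\theta)$. A detector emits $e\in\{0,1\}$ with probability $\lambda(e\,|\,\theta,m)$, where $\lambda(1\,|\,\theta,m)=\beta$ if $m\neq\theta$ and $\alpha$ if $m=\theta$. The receiver $R$ observes $(m,e)$ and plays $a\in\{0,1\}$ with probability $\sigma^R(a\,|\,m,e)$. Utilities $u^S(\theta,m,a),u^R(\theta,m,a)\in\mathbb R$ satisfy: neither depends on $m$; $u^R(0,m,0)>u^R(0,m,1)$, $u^R(1,m,1)>u^R(1,m,0)$; $u^S(0,m,0)<u^S(0,m,1)$, $u^S(1,m,0)>u^S(1,m,1)$. Put $\Delta_0^R=u^R(0,m,0)-u^R(0,m,1)$, $\Delta_1^R=u^R(1,m,1)-u^R(1,m,0)$. Detector quality is $J=\beta-\alpha$ and aggressiveness is $G=\beta-(1-\alpha)$,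 so $\alpha=(1+G-J)/2$, $\beta=(1+G+J)/2$. Write $\bar\alpha=1-\alpha$, $\bar\beta=1-\beta$, and let the regime boundaries be $$T_1=\frac{\alpha\Delta_0^R}{\alpha\Delta_0^R+\beta\Delta_1^R},\quad T_2=\frac{\bar\beta\Delta_0^R}{\bar\beta\Delta_0^R+\bar\alpha\Delta_1^R},\quad T_3=\frac{\bar\alpha\Delta_0^R}{\bar\alpha\Delta_0^R+\bar\beta\Delta_1^R},\quad T_4=\frac{\beta\Delta_0^R}{\beta\Delta_0^R+\alpha\Delta_1^R}.$$ The equilibrium strategies $(\sigma^{S*},\sigma^{R*})$ (perfect Bayesian Nash equilibria of the game) are as follows. "$S$ pools on $m$" means both types send $m$ with probability 1; "$R$ plays $a$" means $\sigma^{R*}(a\,|\,m,e)=1$ for all $m,e$. Case $G<0$. $p<T_1$: $S$ pools on either message, $R$ plays $0$. $T_1<p<T_2$: $S$ pools on $1$, $R$ plays $0$. $T_3<p<T_4$: $S$ pools on $0$, $R$ plays $1$. $p>T_4$: $S$ pools on either message, $R$ plays $1$. $T_2<p<T_3$: $\sigma^{S*}(1|0)=\frac{\bar\alpha^2}{\bar\alpha^2-\bar\beta^2}-\frac{\bar\alpha\bar\beta\Delta_1^R}{(\bar\alpha^2-\bar\beta^2)\Delta_0^R}\frac{p}{1-p}$, $\sigma^{S*}(1|1)=\frac{\bar\alpha\bar\beta\Delta_0^R}{(\bar\alpha^2-\bar\beta^2)\Delta_1^R}\frac{1-p}{p}-\frac{\bar\beta^2}{\bar\alpha^2-\bar\beta^2}$,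 $\sigma^{R*}(1|0,0)=\frac{1-\alpha-\beta}{2-\alpha-\beta}$, $\sigma^{R*}(1|0,1)=1$, $\sigma^{R*}(1|1,0)=\frac1{2-\alpha-\beta}$, $\sigma^{R*}(1|1,1)=0$. Case $G>0$. $p<T_2$: $S$ pools on either message, $R$ plays $0$. $T_2<p<T_1$: $S$ pools on $0$, $R$ plays $0$. $T_4<p<T_3$: $S$ pools on $1$, $R$ plays $1$. $p>T_3$: $S$ pools on either message, $R$ plays $1$. $T_1<p<T_4$: $\sigma^{S*}(1|0)=\frac{\alpha\beta\Delta_1^R}{(\beta^2-\alpha^2)\Delta_0^R}\frac{p}{1-p}-\frac{\alpha^2}{\beta^2-\alpha^2}$, $\sigma^{S*}(1|1)=\frac{\beta^2}{\beta^2-\alpha^2}-\frac{\alpha\beta\Delta_0^R}{(\beta^2-\alpha^2)\Delta_1^R}\frac{1-p}{p}$, $\sigma^{R*}(1|0,0)=0$, $\sigma^{R*}(1|0,1)=\frac1{\alpha+\beta}$, $\sigma^{R*}(1|1,0)=1$, $\sigma^{R*}(1|1,1)=\frac{\alpha+\beta-1}{\alpha+\beta}$. The a priori expected equilibrium utility of $S$ is $$\tilde U^S=\sum_{\theta,m,e,a}p(\theta)\,\sigma^{S*}(m\,|\,\theta)\,\lambda(e\,|\,\theta,m)\,\sigma^{R*}(a\,|\,m,e)\,u^S(\theta,m,a)$$ (where two pooling equilibria are listed they give the same value). *)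

theory Defs
  imports Complex_Main "HOL-Library.Z2"
begin

text \<open>
  Types, messages, evidence and actions all range over the two-element type \<^typ>\<open>bit\<close>, used
  only for its constants 0 and 1. Argument orders follow the conditional notation:
  \<open>\<sigma>S m \<theta>\<close> is \<open>\<sigma>S(m | \<theta>)\<close>, \<open>\<sigma>R a m e\<close> is \<open>\<sigma>R(a | m, e)\<close>, and
  \<open>\<mu> \<theta> m e\<close> is \<open>\<mu>(\<theta> | m, e)\<close>.
\<close>

type_synonym utility = "bit \<Rightarrow> bit \<Rightarrow> bit \<Rightarrow> real"

definition is_distribution :: "(bit \<Rightarrow> real) \<Rightarrow> bool" where
  "is_distribution q \<longleftrightarrow> (\<forall>x. 0 \<le> q x) \<and> (\<Sum>x\<in>{0, 1}. q x) = 1"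

definition prior :: "real \<Rightarrow> bit \<Rightarrow> real" where
  "prior p \<theta> = (if \<theta> = 1 then p else 1 - p)"

definition admissible_utilities :: "utility \<Rightarrow> utility \<Rightarrow> bool" where
  "admissible_utilities uS uR \<longleftrightarrow>
     (\<forall>\<theta> m m' a. uS \<theta> m a = uS \<theta> m' a) \<and>
     (\<forall>\<theta> m m' a. uR \<theta> m a = uR \<theta> m' a) \<and>
     (\<forall>m. uR 0 m 0 > uR 0 m 1) \<and> (\<forall>m. uR 1 m 1 > uR 1 m 0) \<and>
     (\<forall>m. uS 0 m 0 < uS 0 m 1) \<and> (\<forall>m. uS 1 m 0 > uS 1 m 1)"

text \<open>Admissible utilities do not depend on the message, so it is fixed to 0 here.\<close>

definition Delta0 :: "utility \<Rightarrow> real" where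
  "Delta0 uR = uR 0 0 0 - uR 0 0 1"

definition Delta1 :: "utility \<Rightarrow> real" where
  "Delta1 uR = uR 1 0 1 - uR 1 0 0"

text \<open>The detector is parametrised by its quality \<open>J\<close> and aggressiveness \<open>G\<close>.\<close>

definition alpha :: "real \<Rightarrow> real \<Rightarrow> real" where
  "alpha J G = (1 + G - J) / 2"

definition beta :: "real \<Rightarrow> real \<Rightarrow> real" where
  "beta J G = (1 + G + J) / 2"

definition detector :: "real \<Rightarrow> real \<Rightarrow> bit \<Rightarrow> bit \<Rightarrow> bit \<Rightarrow> real" where
  "detector J G e \<theta> m =
     (let q = (if m \<noteq> \<theta> then beta J G else alpha J G) in if e = 1 then q else 1 - q)"

definition sender_strategy :: "(bit \<Rightarrow> bit \<Rightarrow> real) \<Rightarrow> bool" where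
  "sender_strategy \<sigma>S \<longleftrightarrow> (\<forall>\<theta>. is_distribution (\<lambda>m. \<sigma>S m \<theta>))"

definition receiver_strategy :: "(bit \<Rightarrow> bit \<Rightarrow> bit \<Rightarrow> real) \<Rightarrow> bool" where
  "receiver_strategy \<sigma>R \<longleftrightarrow> (\<forall>m e. is_distribution (\<lambda>a. \<sigma>R a m e))"

definition sender_payoff ::
    "utility \<Rightarrow> real \<Rightarrow> real \<Rightarrow> (bit \<Rightarrow> bit \<Rightarrow> bit \<Rightarrow> real) \<Rightarrow> bit \<Rightarrow> (bit \<Rightarrow> real) \<Rightarrow> real" where
  "sender_payoff uS J G \<sigma>R \<theta> s =
     (\<Sum>m\<in>{0, 1}. \<Sum>e\<in>{0, 1}. \<Sum>a\<in>{0, 1}. s m * detector J G e \<theta> m * \<sigma>R a m e * uS \<theta> m a)"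

definition receiver_payoff ::
    "utility \<Rightarrow> (bit \<Rightarrow> bit \<Rightarrow> bit \<Rightarrow> real) \<Rightarrow> bit \<Rightarrow> bit \<Rightarrow> (bit \<Rightarrow> real) \<Rightarrow> real" where
  "receiver_payoff uR \<mu> m e r = (\<Sum>\<theta>\<in>{0, 1}. \<Sum>a\<in>{0, 1}. \<mu> \<theta> m e * r a * uR \<theta> m a)"

text \<open>
  Beliefs are updated in two steps: an interim belief \<open>\<nu> \<theta> m\<close> after the message, then
  \<open>\<mu> \<theta> m e\<close> after the evidence. Each step uses Bayes' rule whenever the conditioning event
  has positive probability and is an arbitrary distribution otherwise; hence off-path messages
  still require the evidence to be processed with the detector's likelihoods.
\<close>

definition consistent_beliefs ::
    "real \<Rightarrow> real \<Rightarrow> real \<Rightarrow> (bit \<Rightarrow> bit \<Rightarrow> real) \<Rightarrow> (bit \<Rightarrow> bit \<Rightarrow> bit \<Rightarrow> real) \<Rightarrow> bool" where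
  "consistent_beliefs J G p \<sigma>S \<mu> \<longleftrightarrow>
     (\<exists>\<nu>. \<forall>m.
        is_distribution (\<lambda>\<theta>. \<nu> \<theta> m) \<and>
        ((\<Sum>t\<in>{0, 1}. \<sigma>S m t * prior p t) > 0 \<longrightarrow>
           (\<forall>\<theta>. \<nu> \<theta> m = \<sigma>S m \<theta> * prior p \<theta> / (\<Sum>t\<in>{0, 1}. \<sigma>S m t * prior p t))) \<and>
        (\<forall>e. is_distribution (\<lambda>\<theta>. \<mu> \<theta> m e) \<and>
           ((\<Sum>t\<in>{0, 1}. detector J G e t m * \<nu> t m) > 0 \<longrightarrow>
              (\<forall>\<theta>. \<mu> \<theta> m e =
                 detector J G e \<theta> m * \<nu> \<theta> m / (\<Sum>t\<in>{0, 1}. detector J G e t m * \<nu> t m)))))"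

definition pbne ::
    "utility \<Rightarrow> utility \<Rightarrow> real \<Rightarrow> real \<Rightarrow> real \<Rightarrow>
     (bit \<Rightarrow> bit \<Rightarrow> real) \<Rightarrow> (bit \<Rightarrow> bit \<Rightarrow> bit \<Rightarrow> real) \<Rightarrow> bool" where
  "pbne uS uR J G p \<sigma>S \<sigma>R \<longleftrightarrow>
     sender_strategy \<sigma>S \<and> receiver_strategy \<sigma>R \<and>
     (\<forall>\<theta> s. is_distribution s \<longrightarrow>
        sender_payoff uS J G \<sigma>R \<theta> s \<le> sender_payoff uS J G \<sigma>R \<theta> (\<lambda>m. \<sigma>S m \<theta>)) \<and>
     (\<exists>\<mu>. consistent_beliefs J G p \<sigma>S \<mu> \<and>
        (\<forall>m e r. is_distribution r \<longrightarrow>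
           receiver_payoff uR \<mu> m e r \<le> receiver_payoff uR \<mu> m e (\<lambda>a. \<sigma>R a m e)))"

definition T1 :: "utility \<Rightarrow> real \<Rightarrow> real \<Rightarrow> real" where
  "T1 uR J G = alpha J G * Delta0 uR / (alpha J G * Delta0 uR + beta J G * Delta1 uR)"

definition T2 :: "utility \<Rightarrow> real \<Rightarrow> real \<Rightarrow> real" where
  "T2 uR J G = (1 - beta J G) * Delta0 uR /
     ((1 - beta J G) * Delta0 uR + (1 - alpha J G) * Delta1 uR)"

definition T3 :: "utility \<Rightarrow> real \<Rightarrow> real \<Rightarrow> real" where
  "T3 uR J G = (1 - alpha J G) * Delta0 uR /
     ((1 - alpha J G) * Delta0 uR + (1 - beta J G) * Delta1 uR)"

definition T4 :: "utility \<Rightarrow> real \<Rightarrow> real \<Rightarrow> real" where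
  "T4 uR J G = beta J G * Delta0 uR / (beta J G * Delta0 uR + alpha J G * Delta1 uR)"

definition pools_on :: "bit \<Rightarrow> (bit \<Rightarrow> bit \<Rightarrow> real) \<Rightarrow> bool" where
  "pools_on m \<sigma>S \<longleftrightarrow> (\<forall>\<theta>. \<sigma>S m \<theta> = 1)"

definition always_plays :: "bit \<Rightarrow> (bit \<Rightarrow> bit \<Rightarrow> bit \<Rightarrow> real) \<Rightarrow> bool" where
  "always_plays a \<sigma>R \<longleftrightarrow> (\<forall>m e. \<sigma>R a m e = 1)"

definition mixed_conservative ::
    "utility \<Rightarrow> real \<Rightarrow> real \<Rightarrow> real \<Rightarrow>
     (bit \<Rightarrow> bit \<Rightarrow> real) \<Rightarrow> (bit \<Rightarrow> bit \<Rightarrow> bit \<Rightarrow> real) \<Rightarrow> bool" where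
  "mixed_conservative uR J G p \<sigma>S \<sigma>R \<longleftrightarrow>
     (let a = alpha J G; b = beta J G; a' = 1 - a; b' = 1 - b;
          d0 = Delta0 uR; d1 = Delta1 uR in
      \<sigma>S 1 0 = a'\<^sup>2 / (a'\<^sup>2 - b'\<^sup>2) - a' * b' * d1 / ((a'\<^sup>2 - b'\<^sup>2) * d0) * (p / (1 - p)) \<and>
      \<sigma>S 1 1 = a' * b' * d0 / ((a'\<^sup>2 - b'\<^sup>2) * d1) * ((1 - p) / p) - b'\<^sup>2 / (a'\<^sup>2 - b'\<^sup>2) \<and>
      \<sigma>R 1 0 0 = (1 - a - b) / (2 - a - b) \<and> \<sigma>R 1 0 1 = 1 \<and>
      \<sigma>R 1 1 0 = 1 / (2 - a - b) \<and> \<sigma>R 1 1 1 = 0)"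

definition mixed_aggressive ::
    "utility \<Rightarrow> real \<Rightarrow> real \<Rightarrow> real \<Rightarrow>
     (bit \<Rightarrow> bit \<Rightarrow> real) \<Rightarrow> (bit \<Rightarrow> bit \<Rightarrow> bit \<Rightarrow> real) \<Rightarrow> bool" where
  "mixed_aggressive uR J G p \<sigma>S \<sigma>R \<longleftrightarrow>
     (let a = alpha J G; b = beta J G; d0 = Delta0 uR; d1 = Delta1 uR in
      \<sigma>S 1 0 = a * b * d1 / ((b\<^sup>2 - a\<^sup>2) * d0) * (p / (1 - p)) - a\<^sup>2 / (b\<^sup>2 - a\<^sup>2) \<and>
      \<sigma>S 1 1 = b\<^sup>2 / (b\<^sup>2 - a\<^sup>2) - a * b * d0 / ((b\<^sup>2 - a\<^sup>2) * d1) * ((1 - p) / p) \<and>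
      \<sigma>R 1 0 0 = 0 \<and> \<sigma>R 1 0 1 = 1 / (a + b) \<and>
      \<sigma>R 1 1 0 = 1 \<and> \<sigma>R 1 1 1 = (a + b - 1) / (a + b))"

text \<open>
  The equilibrium profiles selected in each parameter regime. Profiles are required to be pairs
  of strategies, so the values of \<open>\<sigma>S 0 \<theta>\<close> and \<open>\<sigma>R 0 m e\<close> are determined by the listed ones.
\<close>

definition regime_profile ::
    "utility \<Rightarrow> real \<Rightarrow> real \<Rightarrow> real \<Rightarrow>
     (bit \<Rightarrow> bit \<Rightarrow> real) \<Rightarrow> (bit \<Rightarrow> bit \<Rightarrow> bit \<Rightarrow> real) \<Rightarrow> bool" where
  "regime_profile uR J G p \<sigma>S \<sigma>R \<longleftrightarrow>
     sender_strategy \<sigma>S \<and> receiver_strategy \<sigma>R \<and>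
     (let t1 = T1 uR J G; t2 = T2 uR J G; t3 = T3 uR J G; t4 = T4 uR J G in
      (G < 0 \<and>
        (p < t1 \<and> (pools_on 0 \<sigma>S \<or> pools_on 1 \<sigma>S) \<and> always_plays 0 \<sigma>R \<or>
         t1 < p \<and> p < t2 \<and> pools_on 1 \<sigma>S \<and> always_plays 0 \<sigma>R \<or>
         t2 < p \<and> p < t3 \<and> mixed_conservative uR J G p \<sigma>S \<sigma>R \<or>
         t3 < p \<and> p < t4 \<and> pools_on 0 \<sigma>S \<and> always_plays 1 \<sigma>R \<or>
         p > t4 \<and> (pools_on 0 \<sigma>S \<or> pools_on 1 \<sigma>S) \<and> always_plays 1 \<sigma>R)) \<or>
      (G > 0 \<and>
        (p < t2 \<and> (pools_on 0 \<sigma>S \<or> pools_on 1 \<sigma>S) \<and> always_plays 0 \<sigma>R \<or>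
         t2 < p \<and> p < t1 \<and> pools_on 0 \<sigma>S \<and> always_plays 0 \<sigma>R \<or>
         t1 < p \<and> p < t4 \<and> mixed_aggressive uR J G p \<sigma>S \<sigma>R \<or>
         t4 < p \<and> p < t3 \<and> pools_on 1 \<sigma>S \<and> always_plays 1 \<sigma>R \<or>
         p > t3 \<and> (pools_on 0 \<sigma>S \<or> pools_on 1 \<sigma>S) \<and> always_plays 1 \<sigma>R)))"

definition sender_expected_utility ::
    "utility \<Rightarrow> real \<Rightarrow> real \<Rightarrow> real \<Rightarrow>
     (bit \<Rightarrow> bit \<Rightarrow> real) \<Rightarrow> (bit \<Rightarrow> bit \<Rightarrow> bit \<Rightarrow> real) \<Rightarrow> real" where
  "sender_expected_utility uS J G p \<sigma>S \<sigma>R =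
     (\<Sum>\<theta>\<in>{0, 1}. \<Sum>m\<in>{0, 1}. \<Sum>e\<in>{0, 1}. \<Sum>a\<in>{0, 1}.
        prior p \<theta> * \<sigma>S m \<theta> * detector J G e \<theta> m * \<sigma>R a m e * uS \<theta> m a)"

text \<open>
  \<open>U\<close> is the a priori expected equilibrium utility of the sender: a profile of the current regime
  exists, and every such profile is an equilibrium that gives the sender \<open>U\<close>.
\<close>

definition is_sender_equilibrium_utility ::
    "utility \<Rightarrow> utility \<Rightarrow> real \<Rightarrow> real \<Rightarrow> real \<Rightarrow> real \<Rightarrow> bool" where
  "is_sender_equilibrium_utility uS uR J G p U \<longleftrightarrow>
     (\<exists>\<sigma>S \<sigma>R. regime_profile uR J G p \<sigma>S \<sigma>R) \<and>
     (\<forall>\<sigma>S \<sigma>R. regime_profile uR J G p \<sigma>S \<sigma>R \<longrightarrow>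
        pbne uS uR J G p \<sigma>S \<sigma>R \<and> sender_expected_utility uS J G p \<sigma>S \<sigma>R = U)"

end

theory Submission
  imports Defs
begin

text \<open>
  At \<open>p = 2/5\<close> and \<open>G = -1/2\<close>, quality \<open>J = 1/4\<close> lies in the pooling regime \<open>T1 < p < T2\<close>, where
  the receiver ignores all evidence and plays 0, whereas \<open>J = 1/2\<close> lies in the mixed regime. There
  the receiver plays 1 against type 0 with probability 1/3 and against type 1 with probability 2/3.
  Hence the better detector helps the sender as soon as type 0 gains enough from action 1.
\<close>

lemma all_bit_iff: "(\<forall>x::bit. P x) \<longleftrightarrow> P 0 \<and> P 1"
  by (metis bit.exhaust)

lemma is_distribution_iff: "is_distribution q \<longleftrightarrow> 0 \<le> q 0 \<and> 0 \<le> q 1 \<and> q 0 + q 1 = 1"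
  by (auto simp: is_distribution_def all_bit_iff)

text \<open>With this choice the receiver maximises the probability of guessing the type, and
  \<open>Delta0\<close> and \<open>Delta1\<close> are both 1, so they drop out of every regime
  boundary.\<close>

definition guess_utility :: utility where
  "guess_utility \<theta> m a = (if a = \<theta> then 1 else 0)"

text \<open>Action 0 is worth nothing, so pooling against it yields 0. Any gain above 4/3 for type 0
  would outweigh the expected loss of type 1 in the mixed regime.\<close>

definition deceiver_utility :: utility where
  "deceiver_utility \<theta> m a = (if a = 1 then if \<theta> = 0 then 2 else -1 else 0)"

lemma admissible_guess_deceiver: "admissible_utilities deceiver_utility guess_utility"
  by (simp add: admissible_utilities_def guess_utility_def deceiver_utility_def)

lemma thresholds_guess:
  "T1 guess_utility J G = alpha J G / (alpha J G + beta J G)"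
  "T2 guess_utility J G = (1 - beta J G) / ((1 - beta J G) + (1 - alpha J G))"
  "T3 guess_utility J G = (1 - alpha J G) / ((1 - alpha J G) + (1 - beta J G))"
  "T4 guess_utility J G = beta J G / (beta J G + alpha J G)"
  by (simp_all add: T1_def T2_def T3_def T4_def Delta0_def Delta1_def guess_utility_def)

lemma receiver_payoff_guess:
  "receiver_payoff guess_utility \<mu> m e r = \<mu> 0 m e * r 0 + \<mu> 1 m e * r 1"
  by (simp add: receiver_payoff_def guess_utility_def)

lemma convex_combination_le:
  fixes a b c x y :: real
  assumes "0 \<le> x" "0 \<le> y" "x + y = 1" "a \<le> c" "b \<le> c"
  shows "a * x + b * y \<le> c"
  using convex_bound_le[of a c b x y] assms by (simp add: mult.commute)

text \<open>Here \<alpha> = 1/8 and \<beta> = 3/8, so the boundaries are 1/4 < 5/12 < 7/12 < 3/4 and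
  2/5 lies between the first two.\<close>

lemma low_quality_profile_iff:
  "regime_profile guess_utility (1/4) (-(1/2)) (2/5) \<sigma>S \<sigma>R \<longleftrightarrow>
     sender_strategy \<sigma>S \<and> receiver_strategy \<sigma>R \<and> pools_on 1 \<sigma>S \<and> always_plays 0 \<sigma>R"
  by (simp add: regime_profile_def Let_def thresholds_guess alpha_def beta_def)

lemma low_quality_utility:
  "is_sender_equilibrium_utility deceiver_utility guess_utility (1/4) (-(1/2)) (2/5) 0"
  unfolding is_sender_equilibrium_utility_def
proof (intro conjI allI impI)
  show "\<exists>\<sigma>S \<sigma>R. regime_profile guess_utility (1/4) (-(1/2)) (2/5) \<sigma>S \<sigma>R"
    by (rule exI[of _ "\<lambda>m \<theta>. if m = 1 then 1 else 0"],
        rule exI[of _ "\<lambda>a m e. if a = 0 then 1 else 0"])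
      (simp add: low_quality_profile_iff sender_strategy_def receiver_strategy_def
        is_distribution_iff pools_on_def always_plays_def)
next
  fix \<sigma>S \<sigma>R
  assume "regime_profile guess_utility (1/4) (-(1/2)) (2/5) \<sigma>S \<sigma>R"
  then have strategies: "sender_strategy \<sigma>S" "receiver_strategy \<sigma>R"
    and S1: "\<And>\<theta>. \<sigma>S 1 \<theta> = 1" and R0: "\<And>m e. \<sigma>R 0 m e = 1"
    by (auto simp: low_quality_profile_iff pools_on_def always_plays_def)
  have S0: "\<sigma>S 0 \<theta> = 0" for \<theta>
    using strategies(1) by (simp add: sender_strategy_def is_distribution_iff S1)
  have R1: "\<sigma>R 1 m e = 0" for m e
    using strategies(2) by (simp add: receiver_strategy_def is_distribution_iff R0)
  show "sender_expected_utility deceiver_utility (1/4) (-(1/2)) (2/5) \<sigma>S \<sigma>R = 0"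
    by (simp add: sender_expected_utility_def R1 deceiver_utility_def)
  \<comment> \<open>Off the path, after message 0, the receiver is certain to face type 0.\<close>
  define \<mu> :: "bit \<Rightarrow> bit \<Rightarrow> bit \<Rightarrow> real" where
    "\<mu> \<theta> m e = (let \<kappa> = (if m = 0 then 1 else if e = 0 then 15/29 else 9/11)
                 in if \<theta> = 0 then \<kappa> else 1 - \<kappa>)" for \<theta> m e
  \<comment> \<open>Message 1 leaves the prior odds 3:2 for type 0. The likelihood ratios 5:7 for
    \<open>e = 0\<close> and 3:1 for \<open>e = 1\<close> turn them into 15:14 and 9:2.\<close>
  have "consistent_beliefs (1/4) (-(1/2)) (2/5) \<sigma>S \<mu>"
    unfolding consistent_beliefs_def
    by (rule exI[of _ "\<lambda>\<theta> m. if m = 0 then if \<theta> = 0 then 1 else 0 else prior (2/5) \<theta>"])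
      (simp add: all_bit_iff is_distribution_iff \<mu>_def prior_def detector_def alpha_def beta_def
        S0 S1)
  \<comment> \<open>Type 0 has belief above 1/2 at every pair \<open>m\<close>, \<open>e\<close>, so
    no mixture beats action 0.\<close>
  moreover have "receiver_payoff guess_utility \<mu> m e r
      \<le> receiver_payoff guess_utility \<mu> m e (\<lambda>a. \<sigma>R a m e)" if "is_distribution r" for m e r
    using that unfolding receiver_payoff_guess is_distribution_iff R0 R1
    by (auto intro!: convex_combination_le simp: \<mu>_def Let_def)
  ultimately show "pbne deceiver_utility guess_utility (1/4) (-(1/2)) (2/5) \<sigma>S \<sigma>R"
    unfolding pbne_def using strategies
    by (auto simp: sender_payoff_def R1 deceiver_utility_def)
qed

text \<open>Here \<alpha> = 0 and \<beta> = 1/2: quality attains its bound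
  \<open>1 - \<bar>G\<bar>\<close> and there are no false alarms. The boundaries are 0, 1/3, 2/3 and
  1.\<close>

lemma high_quality_profile_iff:
  "regime_profile guess_utility (1/2) (-(1/2)) (2/5) \<sigma>S \<sigma>R \<longleftrightarrow>
     sender_strategy \<sigma>S \<and> receiver_strategy \<sigma>R \<and> \<sigma>S 1 0 = 8/9 \<and> \<sigma>S 1 1 = 2/3 \<and>
     \<sigma>R 1 0 0 = 1/3 \<and> \<sigma>R 1 0 1 = 1 \<and> \<sigma>R 1 1 0 = 2/3 \<and> \<sigma>R 1 1 1 = 0"
  by (simp add: regime_profile_def Let_def thresholds_guess alpha_def beta_def
      mixed_conservative_def Delta0_def Delta1_def guess_utility_def power2_eq_square)

lemma high_quality_utility:
  "is_sender_equilibrium_utility deceiver_utility guess_utility (1/2) (-(1/2)) (2/5) (2/15)"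
  unfolding is_sender_equilibrium_utility_def
proof (intro conjI allI impI)
  show "\<exists>\<sigma>S \<sigma>R. regime_profile guess_utility (1/2) (-(1/2)) (2/5) \<sigma>S \<sigma>R"
    by (rule exI[of _ "\<lambda>m \<theta>. let s = (if \<theta> = 0 then 8/9 else 2/3)
            in if m = 1 then s else 1 - s"],
        rule exI[of _ "\<lambda>a m e. let r = (if m = 0 then if e = 0 then 1/3 else 1
              else if e = 0 then 2/3 else 0)
            in if a = 1 then r else 1 - r"])
      (simp add: high_quality_profile_iff sender_strategy_def receiver_strategy_def
        is_distribution_iff Let_def)
next
  fix \<sigma>S \<sigma>R
  assume "regime_profile guess_utility (1/2) (-(1/2)) (2/5) \<sigma>S \<sigma>R"
  then have strategies: "sender_strategy \<sigma>S" "receiver_strategy \<sigma>R"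
    and S1: "\<sigma>S 1 0 = 8/9" "\<sigma>S 1 1 = 2/3"
    and R1: "\<sigma>R 1 0 0 = 1/3" "\<sigma>R 1 0 1 = 1" "\<sigma>R 1 1 0 = 2/3" "\<sigma>R 1 1 1 = 0"
    by (auto simp: high_quality_profile_iff)
  have S0: "\<sigma>S 0 0 = 1/9" "\<sigma>S 0 1 = 1/3"
    using strategies(1) S1 by (simp_all add: sender_strategy_def is_distribution_iff all_bit_iff)
  have R0: "\<sigma>R 0 0 0 = 2/3" "\<sigma>R 0 0 1 = 0" "\<sigma>R 0 1 0 = 1/3" "\<sigma>R 0 1 1 = 1"
    using strategies(2) R1 by (simp_all add: receiver_strategy_def is_distribution_iff all_bit_iff)
  \<comment> \<open>The value is 3/5 * 1/3 * 2 - 2/5 * 2/3.\<close>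
  show "sender_expected_utility deceiver_utility (1/2) (-(1/2)) (2/5) \<sigma>S \<sigma>R = 2/15"
    by (simp add: sender_expected_utility_def S0 S1 R1 deceiver_utility_def prior_def
        detector_def alpha_def beta_def)
  \<comment> \<open>Either message induces action 1 with the same probability: 1/3 for type 0 and
    2/3 for type 1.\<close>
  have indifferent: "sender_payoff deceiver_utility (1/2) (-(1/2)) \<sigma>R \<theta> s
      = (if \<theta> = 0 then 2/3 else -2/3)" if "is_distribution s" for \<theta> s
  proof -
    have "s 1 = 1 - s 0"
      using that by (simp add: is_distribution_iff)
    then show ?thesis
      by (cases \<theta>) (simp_all add: sender_payoff_def R1 deceiver_utility_def
          detector_def alpha_def beta_def field_simps)
  qed
  \<comment> \<open>After either message the odds of a lie are 2:1. A lie escapes detection half the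
    time, so silence makes the odds even, whereas an alarm proves a lie.\<close>
  define \<mu> :: "bit \<Rightarrow> bit \<Rightarrow> bit \<Rightarrow> real" where
    "\<mu> \<theta> m e = (if e = 0 then 1/2 else if \<theta> = m then 0 else 1)" for \<theta> m e
  have "consistent_beliefs (1/2) (-(1/2)) (2/5) \<sigma>S \<mu>"
    unfolding consistent_beliefs_def
    by (rule exI[of _ "\<lambda>\<theta> m. if \<theta> = m then 1/3 else 2/3"])
      (simp add: all_bit_iff is_distribution_iff \<mu>_def prior_def detector_def alpha_def beta_def
        S0 S1)
  \<comment> \<open>Without an alarm all actions are equally good; after one, the receiver plays the
    opposite of the message and is certainly right.\<close>
  moreover have "receiver_payoff guess_utility \<mu> m e r
      \<le> receiver_payoff guess_utility \<mu> m e (\<lambda>a. \<sigma>R a m e)" if "is_distribution r" for m e r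
    using that unfolding receiver_payoff_guess is_distribution_iff
    by (cases m; cases e) (simp_all add: \<mu>_def R0 R1)
  ultimately show "pbne deceiver_utility guess_utility (1/2) (-(1/2)) (2/5) \<sigma>S \<sigma>R"
    unfolding pbne_def using strategies indifferent
    by (auto simp: sender_strategy_def)
qed

theorem corollary1:
  shows "\<exists>(uS :: utility) (uR :: utility) (G :: real) (p :: real) (J1 :: real) (J2 :: real)
           (U1 :: real) (U2 :: real).
    admissible_utilities uS uR \<and>
    -1 < G \<and> G < 1 \<and> G \<noteq> 0 \<and> 0 < p \<and> p < 1 \<and>
    0 < J1 \<and> J1 < J2 \<and> J2 \<le> 1 - \<bar>G\<bar> \<and>
    p \<notin> {T1 uR J1 G, T2 uR J1 G, T3 uR J1 G, T4 uR J1 G} \<and>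
    p \<notin> {T1 uR J2 G, T2 uR J2 G, T3 uR J2 G, T4 uR J2 G} \<and>
    is_sender_equilibrium_utility uS uR J1 G p U1 \<and>
    is_sender_equilibrium_utility uS uR J2 G p U2 \<and>
    U1 < U2"
  by (rule exI[of _ deceiver_utility], rule exI[of _ guess_utility], rule exI[of _ "-(1/2)"],
      rule exI[of _ "2/5"], rule exI[of _ "1/4"], rule exI[of _ "1/2"], rule exI[of _ 0],
      rule exI[of _ "2/15"],
      intro conjI low_quality_utility high_quality_utility admissible_guess_deceiver)
    (simp_all add: thresholds_guess alpha_def beta_def)

end
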